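(* For every $n\ge 1$ and every permutation $\pi\in S_n$, there is a tangle performing $\pi$ that has at most $4n$ moves in total (summed over all $n$ paths).
   Context: $S_n$ is the symmetric group on $\{1,\ldots,n\}$; a permutation is written $\pi=[\pi(1),\ldots,\pi(n)]$, and $\mathrm{id}=[1,\ldots,n]$. Two permutations $\pi,\rho\in S_n$ are adjacent if $|\pi^{-1}(i)-\rho^{-1}(i)|\le 1$ for every $i\in\{1,\ldots,n\}$ (so equal permutations are adjacent). A tangle is a finite sequence $\pi_1,\ldots,\pi_N$ of permutations in $S_n$ in which each consecutive pair is adjacent. A tangle performs $\pi$ if its first permutation is $\mathrm{id}$ and its last is $\pi$. For an element $i$, path $i$ is the sequence of positions $\pi_1^{-1}(i),\pi_2^{-1}(i),\ldots,\pi_N^{-1}(i)$. A move of path $i$ is a maximal subsequence of at least two consecutive permutations of the tangle during which the positions of $i$ form an arithmetic progression of common difference $+1$, or of common difference $-1$. *)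

theory Defs
  imports Main "HOL-Combinatorics.Permutations"
begin

text \<open>
  The symmetric group on \<open>{1..n}\<close> consists of the functions \<open>p\<close> with \<open>p permutes {1..n}\<close>;
  thus \<open>p x\<close> is the element at position \<open>x\<close>, and \<open>inv p i\<close> is the position of element \<open>i\<close>.
  Sequences of permutations are lists, so their indices start at \<open>0\<close>.
\<close>

definition adjacent_perms :: "nat \<Rightarrow> (nat \<Rightarrow> nat) \<Rightarrow> (nat \<Rightarrow> nat) \<Rightarrow> bool" where
  "adjacent_perms n p q \<longleftrightarrow> (\<forall>i\<in>{1..n}. \<bar>int (inv p i) - int (inv q i)\<bar> \<le> 1)"

definition tangle :: "nat \<Rightarrow> (nat \<Rightarrow> nat) list \<Rightarrow> bool" where
  "tangle n T \<longleftrightarrow>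
     T \<noteq> [] \<and> (\<forall>p\<in>set T. p permutes {1..n}) \<and> successively (adjacent_perms n) T"

definition performs :: "(nat \<Rightarrow> nat) list \<Rightarrow> (nat \<Rightarrow> nat) \<Rightarrow> bool" where
  "performs T p \<longleftrightarrow> hd T = id \<and> last T = p"

definition path :: "(nat \<Rightarrow> nat) list \<Rightarrow> nat \<Rightarrow> nat list" where
  "path T i = map (\<lambda>p. inv p i) T"

text \<open>
  \<open>monotone_run xs a b\<close>: the entries of \<open>xs\<close> with indices \<open>a, \<dots>, b\<close> (at least two of them) form an
  arithmetic progression of common difference \<open>1\<close> or \<open>-1\<close>.
\<close>

definition monotone_run :: "nat list \<Rightarrow> nat \<Rightarrow> nat \<Rightarrow> bool" where
  "monotone_run xs a b \<longleftrightarrow> a < b \<and> b < length xs \<and>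
     (\<exists>d\<in>{1, -1}. \<forall>k\<in>{a..<b}. int (xs ! Suc k) - int (xs ! k) = d)"

definition is_move :: "nat list \<Rightarrow> nat \<Rightarrow> nat \<Rightarrow> bool" where
  "is_move xs a b \<longleftrightarrow> monotone_run xs a b \<and>
     (\<forall>a' b'. a' \<le> a \<longrightarrow> b \<le> b' \<longrightarrow> monotone_run xs a' b' \<longrightarrow> a' = a \<and> b' = b)"

definition moves :: "nat list \<Rightarrow> (nat \<times> nat) set" where
  "moves xs = {(a, b). is_move xs a b}"

lemma finite_moves: "finite (moves xs)"
proof (rule finite_subset)
  show "moves xs \<subseteq> {..<length xs} \<times> {..<length xs}"
    by (auto simp: moves_def is_move_def monotone_run_def)
qed simp

definition total_moves :: "nat \<Rightarrow> (nat \<Rightarrow> nat) list \<Rightarrow> nat" where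
  "total_moves n T = (\<Sum>i\<in>{1..n}. card (moves (path T i)))"

end

theory Submission
  imports Defs "HOL-Number_Theory.Cong"
begin

text \<open>
  Let all paths run as in the odd-even transposition network with \<open>n\<close> rounds: a path goes in one
  direction, bounces off the wall and goes back, and every two paths meet exactly once.  When two
  paths meet, the two elements may stay where they are for one step instead of crossing, which
  exchanges their trajectories.  Let \<open>\<sigma>\<close> be the permutation of the trajectories that is still
  to be performed.  Whenever two trajectories in a common cycle of \<open>\<sigma>\<close> meet, exchange them; this
  splits the cycle.  As all pairs meet, \<open>\<sigma>\<close> is the identity at the end, and as every exchange
  creates a new cycle, there are at most \<open>n\<close> exchanges.  An element starts a new move only at the
  beginning or after a rest.  There are \<open>n\<close> rests at the walls and at most \<open>2 n\<close> rests at
  exchanges, hence at most \<open>4 n\<close> moves.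
\<close>

section \<open>Splitting cycles\<close>

text \<open>An injection maps a finite forward-closed set onto itself, so the set is closed under
  preimages too.\<close>

lemma permutes_closed_iff:
  assumes "p permutes S" "finite B" "p ` B \<subseteq> B"
  shows "p x \<in> B \<longleftrightarrow> x \<in> B"
proof -
  have inj: "inj p" using assms(1) permutes_inj by blast
  have "p ` B = B"
    by (rule endo_inj_surj[OF assms(2,3)]) (use inj in \<open>auto simp: inj_on_def\<close>)
  then show ?thesis using inj by (metis inj_image_mem_iff)
qed

text \<open>If \<open>j\<close> is not on the cycle of \<open>i\<close>, that cycle already
  separates them. Otherwise composing with the transposition cuts their common cycle into two, one
  through each point.\<close>

lemma separate_by_transposition:
  assumes p: "p permutes S" and S: "finite S" and i: "i \<in> S" and j: "j \<in> S" and ij: "i \<noteq> j"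
  obtains q B where "q = p \<or> q = p \<circ> transpose i j" "\<And>x. q x \<in> B \<longleftrightarrow> x \<in> B" "(i \<in> B) \<noteq> (j \<in> B)"
proof (cases "\<exists>k. (p ^^ k) i = j")
  case False
  define B where "B = (\<lambda>k. (p ^^ k) i) ` UNIV"
  have "(p ^^ k) i \<in> S" for k
    by (induction k) (use i p in \<open>auto simp: permutes_in_image\<close>)
  then have fin: "finite B"
    using S by (auto simp: B_def intro: finite_subset)
  have "p ((p ^^ k) i) \<in> B" for k
    unfolding B_def by (rule image_eqI[of _ _ "Suc k"]) auto
  then have "p ` B \<subseteq> B" by (auto simp: B_def)
  then have "p x \<in> B \<longleftrightarrow> x \<in> B" for x
    by (rule permutes_closed_iff[OF p fin])
  moreover have "i \<in> B" unfolding B_def by (rule image_eqI[of _ _ 0]) auto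
  moreover have "j \<notin> B" using False by (auto simp: B_def)
  ultimately show ?thesis using that[of p B] by blast
next
  case True
  define k where "k = (LEAST k. (p ^^ k) i = j)"
  have k: "(p ^^ k) i = j" unfolding k_def using True by (rule LeastI_ex)
  have least: "(p ^^ m) i \<noteq> j" if "m < k" for m
    using that not_less_Least unfolding k_def by blast
  have "k \<noteq> 0" using k ij by (intro notI) simp
  \<comment> \<open>The index starts at 1 because \<open>q\<close> sends \<open>j\<close> to
    \<open>p i\<close>: this stretch from \<open>p i\<close> to \<open>j\<close> is the cycle of
    \<open>j\<close> under \<open>q\<close>, and it omits \<open>i\<close>.\<close>
  define B where "B = (\<lambda>m. (p ^^ m) i) ` {1..k}"
  define q where "q = p \<circ> transpose i j"
  have q: "q permutes S"
    unfolding q_def by (intro permutes_compose permutes_swap_id i j p)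
  \<comment> \<open>A return to \<open>i\<close> at step \<open>m\<close> would bring the orbit to
    \<open>j\<close> already at step \<open>k - m\<close>, against the minimality of
    \<open>k\<close>.\<close>
  have notin: "(p ^^ m) i \<noteq> i" if "1 \<le> m" "m \<le> k" for m
  proof
    assume "(p ^^ m) i = i"
    then have "(p ^^ (k - m)) i = (p ^^ (k - m + m)) i" by (simp add: funpow_add)
    also have "\<dots> = j" using k that by simp
    finally show False using least[of "k - m"] that \<open>k \<noteq> 0\<close> by simp
  qed
  have "q ((p ^^ m) i) \<in> B" if "1 \<le> m" "m \<le> k" for m
  proof (cases "m = k")
    case True
    then have "q ((p ^^ m) i) = (p ^^ 1) i" using k by (simp add: q_def)
    then show ?thesis unfolding B_def using \<open>k \<noteq> 0\<close> by (intro image_eqI[of _ _ 1]) auto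
  next
    case False
    then have "q ((p ^^ m) i) = (p ^^ Suc m) i"
      using notin[of m] least[of m] that by (simp add: q_def transpose_apply_other)
    then show ?thesis unfolding B_def using that False by (intro image_eqI[of _ _ "Suc m"]) auto
  qed
  then have "q ` B \<subseteq> B" by (auto simp: B_def)
  then have "q x \<in> B \<longleftrightarrow> x \<in> B" for x
    by (rule permutes_closed_iff[OF q, rotated]) (simp add: B_def)
  moreover have "j \<in> B" unfolding B_def using k \<open>k \<noteq> 0\<close> by (intro image_eqI[of _ _ k]) auto
  moreover have "i \<notin> B" using notin unfolding B_def by fastforce
  ultimately show ?thesis using that[of q B] by (auto simp: q_def)
qed

text \<open>
  A labelling \<open>b\<close> with \<open>b (p x) = b x\<close> stands for a partition into unions of cycles of \<open>p\<close>.
\<close>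

lemma refine_labelling:
  fixes b :: "'a \<Rightarrow> nat"
  assumes p: "p permutes S" and S: "finite S" and i: "i \<in> S" and j: "j \<in> S" and ij: "i \<noteq> j"
    and b: "\<And>x. b (p x) = b x" and bij: "b i = b j"
  obtains q and c :: "'a \<Rightarrow> nat" where
    "q = p \<or> q = p \<circ> transpose i j" "\<And>x. c (q x) = c x" "\<And>x y. c x = c y \<Longrightarrow> b x = b y"
    "c i \<noteq> c j" "card (b ` S) < card (c ` S)"
proof -
  obtain q B where q: "q = p \<or> q = p \<circ> transpose i j" and B: "\<And>x. q x \<in> B \<longleftrightarrow> x \<in> B"
    and sep: "(i \<in> B) \<noteq> (j \<in> B)"
    using separate_by_transposition[OF p S i j ij] by blast
  \<comment> \<open>Doubling makes room for a bit that tells the two sides of \<open>B\<close>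
    apart; \<open>div 2\<close> recovers \<open>b\<close>, so \<open>c\<close> refines
    \<open>b\<close>.\<close>
  define c where "c x = 2 * b x + of_bool (x \<in> B)" for x
  have "b (q x) = b x" for x
    using q b bij by (auto simp: transpose_def)
  then have cq: "c (q x) = c x" for x by (simp add: c_def B)
  have cdiv: "b x = c x div 2" for x by (simp add: c_def)
  have cij: "c i \<noteq> c j" using sep bij by (auto simp: c_def)
  have eq: "b ` S = (\<lambda>x. x div 2) ` c ` S" by (simp add: cdiv image_image)
  have "\<not> inj_on (\<lambda>x. x div 2) (c ` S)"
    using cij bij i j by (auto simp: cdiv inj_on_def)
  then have "card (b ` S) < card (c ` S)"
    unfolding eq using S by (metis card_image_le eq_card_imp_inj_on finite_imageI le_neq_implies_less)
  then show ?thesis using that[of q c] q cq cij cdiv by metis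
qed

section \<open>Factoring a permutation along a sequence of involutions\<close>

definition partial_map :: "('a \<Rightarrow> 'a) \<Rightarrow> 'a set \<Rightarrow> 'a \<Rightarrow> 'a" where
  "partial_map m A x = (if x \<in> A then m x else x)"

lemma partial_map_permutes:
  assumes inv: "\<And>x. x \<in> S \<Longrightarrow> m (m x) = x" and "m ` A \<subseteq> A" "A \<subseteq> S"
  shows "partial_map m A permutes S"
proof (rule bij_imp_permutes)
  show "bij_betw (partial_map m A) S S"
    by (rule bij_betwI[where g = "partial_map m A"]) (use assms in \<open>auto simp: partial_map_def image_subset_iff subset_iff\<close>)
qed (use assms in \<open>auto simp: partial_map_def\<close>)

text \<open>The number of labels is bounded by \<open>card S\<close>, so a choice with the most
  labels exists; a pair \<open>x\<close>, \<open>m x\<close> sharing a label would allow a further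
  refinement. An exchanged pair adds two points to \<open>A\<close> and at least one label, whence
  the factor 2.\<close>

lemma separate_by_involution:
  fixes b :: "'a \<Rightarrow> nat"
  assumes S: "finite S" and m: "\<And>x. x \<in> S \<Longrightarrow> m x \<in> S" and inv: "\<And>x. x \<in> S \<Longrightarrow> m (m x) = x"
    and p: "p permutes S" and b: "\<And>x. b (p x) = b x"
  obtains A and c :: "'a \<Rightarrow> nat" where
    "A \<subseteq> S" "m ` A \<subseteq> A" "\<And>x. c (p (partial_map m A x)) = c x" "\<And>x y. c x = c y \<Longrightarrow> b x = b y"
    "2 * card (b ` S) + card A \<le> 2 * card (c ` S)"
    "\<And>x. x \<in> S \<Longrightarrow> m x \<noteq> x \<Longrightarrow> c x \<noteq> c (m x)"
proof -
  \<comment> \<open>The last clause ensures that a pair still sharing a label lies outside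
    \<open>A\<close>, so no pair is exchanged twice.\<close>
  define I where "I = (\<lambda>(A, c::'a \<Rightarrow> nat). A \<subseteq> S \<and> m ` A \<subseteq> A \<and>
    (\<forall>x. c (p (partial_map m A x)) = c x) \<and> (\<forall>x y. c x = c y \<longrightarrow> b x = b y) \<and>
    2 * card (b ` S) + card A \<le> 2 * card (c ` S) \<and> (\<forall>x\<in>A. c x \<noteq> c (m x)))"
  have "I ({}, b)" using b by (simp add: I_def partial_map_def)
  moreover have "card (snd Ac ` S) < Suc (card S)" if "I Ac" for Ac
    using card_image_le[OF S] by (simp add: less_Suc_eq_le)
  ultimately have "\<exists>Ac. I Ac \<and> (\<forall>Ac'. I Ac' \<longrightarrow> card (snd Ac' ` S) \<le> card (snd Ac ` S))"
    by (intro ex_has_greatest_nat[of I "({}, b)" _ "Suc (card S)"]) auto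
  then obtain Ac where Ac: "I Ac" and max: "\<And>Ac'. I Ac' \<Longrightarrow> card (snd Ac' ` S) \<le> card (snd Ac ` S)"
    by blast
  obtain A c where eq: "Ac = (A, c)" by (cases Ac)
  have A: "A \<subseteq> S" "m ` A \<subseteq> A" and c: "\<And>x. c (p (partial_map m A x)) = c x"
    and refine: "\<And>x y. c x = c y \<Longrightarrow> b x = b y"
    and card: "2 * card (b ` S) + card A \<le> 2 * card (c ` S)"
    and sep: "\<And>x. x \<in> A \<Longrightarrow> c x \<noteq> c (m x)"
    using Ac unfolding I_def eq prod.case by blast+
  have "c x \<noteq> c (m x)" if x: "x \<in> S" and mx: "m x \<noteq> x" for x
  proof
    assume cx: "c x = c (m x)"
    have xA: "x \<notin> A" using sep cx by blast
    have mxA: "m x \<notin> A" using A inv[OF x] xA by (metis image_subset_iff)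
    have perm: "p \<circ> partial_map m A permutes S"
      by (intro permutes_compose partial_map_permutes inv A p)
    have cp: "c ((p \<circ> partial_map m A) y) = c y" for y using c by simp
    obtain q and c' :: "'a \<Rightarrow> nat" where q: "q = p \<circ> partial_map m A \<or> q = p \<circ> partial_map m A \<circ> transpose x (m x)"
      and c': "\<And>y. c' (q y) = c' y" "\<And>y z. c' y = c' z \<Longrightarrow> c y = c z" "c' x \<noteq> c' (m x)"
      and less: "card (c ` S) < card (c' ` S)"
      by (rule refine_labelling[where b = c, OF perm S x m[OF x] mx[symmetric] cp cx]) blast
    have "\<exists>A'. I (A', c')"
    proof (cases "q = p \<circ> partial_map m A")
      case True
      then have "c' (p (partial_map m A y)) = c' y" for y using c'(1)[of y] by simp
      moreover have "2 * card (b ` S) + card A \<le> 2 * card (c' ` S)" using card less by simp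
      moreover have "\<forall>y z. c' y = c' z \<longrightarrow> b y = b z" "\<forall>y\<in>A. c' y \<noteq> c' (m y)"
        using c'(2) refine sep by blast+
      ultimately have "I (A, c')" using A unfolding I_def prod.case by blast
      then show ?thesis ..
    next
      case False
      define A' where "A' = insert x (insert (m x) A)"
      \<comment> \<open>Since \<open>x\<close> and \<open>m x\<close> lie outside \<open>A\<close>,
        the transposition is just \<open>m\<close> on a new pair and is absorbed into
        \<open>A'\<close>.\<close>
      have "partial_map m A (transpose x (m x) y) = partial_map m A' y" for y
        using xA mxA inv[OF x] by (auto simp: partial_map_def A'_def transpose_def)
      then have "c' (p (partial_map m A' y)) = c' y" for y
        using c'(1)[of y] q False by auto
      moreover have "2 * card (b ` S) + card A' \<le> 2 * card (c' ` S)"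
        using card less xA mxA mx finite_subset[OF A(1) S] by (simp add: A'_def)
      moreover have "\<forall>y z. c' y = c' z \<longrightarrow> b y = b z"
        using c'(2) refine by blast
      moreover have "\<forall>y\<in>A'. c' y \<noteq> c' (m y)"
        using c'(2,3) sep inv[OF x] unfolding A'_def by (metis insertE)
      moreover have "A' \<subseteq> S" "m ` A' \<subseteq> A'"
        using A x m inv[OF x] by (auto simp: A'_def)
      ultimately have "I (A', c')" unfolding I_def prod.case by blast
      then show ?thesis ..
    qed
    then obtain A' where "I (A', c')" ..
    then show False using max[of "(A', c')"] less by (simp add: eq)
  qed
  then show ?thesis by (intro that[of A c] A c refine card)
qed

text \<open>The involutions are treated in turn; the invariant \<open>I\<close> keeps
  \<open>p\<close> as the part of \<sigma> still to be performed. Labels are only ever refined, so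
  points once separated stay separated.\<close>

lemma factor_by_involutions:
  fixes m :: "nat \<Rightarrow> 'a \<Rightarrow> 'a"
  assumes S: "finite S" and m: "\<And>k x. x \<in> S \<Longrightarrow> m k x \<in> S"
    and inv: "\<And>k x. x \<in> S \<Longrightarrow> m k (m k x) = x"
    and meet: "\<And>x y. x \<in> S \<Longrightarrow> y \<in> S \<Longrightarrow> x \<noteq> y \<Longrightarrow> \<exists>k<N. m k x = y"
    and \<sigma>: "\<sigma> permutes S"
  obtains E and A :: "nat \<Rightarrow> 'a set" where
    "E 0 = id" "E N = \<sigma>" "\<And>k. E k permutes S"
    "\<And>k x. E (Suc k) x = partial_map (m k) (A k) (E k x)"
    "\<And>k. A k \<subseteq> S" "(\<Sum>k<N. card (A k)) \<le> 2 * card S"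
proof -
  define I where "I M E A (b :: 'a \<Rightarrow> nat) p \<longleftrightarrow> E 0 = id \<and> (\<forall>k. E k permutes S) \<and> (\<forall>k. A k \<subseteq> S) \<and>
      (\<forall>k x. E (Suc k) x = partial_map (m k) (A k) (E k x)) \<and>
      p permutes S \<and> p \<circ> E M = \<sigma> \<and> (\<forall>x. b (p x) = b x) \<and>
      (\<forall>k\<ge>M. A k = {}) \<and>
      (\<forall>k<M. \<forall>x\<in>S. m k x \<noteq> x \<longrightarrow> b x \<noteq> b (m k x)) \<and> (\<Sum>k<M. card (A k)) \<le> 2 * card (b ` S)"
    for M E A b p
  have "\<exists>E A b p. I M E A b p" for M
  proof (induction M)
    case 0
    have "I 0 (\<lambda>_. id) (\<lambda>_. {}) (\<lambda>_. 0) \<sigma>"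
      using \<sigma> permutes_id[of S] by (simp add: I_def partial_map_def)
    then show ?case by blast
  next
    case (Suc M)
    then obtain E A b p where "I M E A b p" by blast
    then have E0: "E 0 = id" and Ep: "\<And>k. E k permutes S"
      and AS: "\<And>k. A k \<subseteq> S" and E: "\<And>k x. E (Suc k) x = partial_map (m k) (A k) (E k x)"
      and p: "p permutes S" and pE: "p \<circ> E M = \<sigma>" and b: "\<And>x. b (p x) = b x"
      and Aempty: "\<And>k. k \<ge> M \<Longrightarrow> A k = {}"
      and sep: "\<And>k x. k < M \<Longrightarrow> x \<in> S \<Longrightarrow> m k x \<noteq> x \<Longrightarrow> b x \<noteq> b (m k x)"
      and sum: "(\<Sum>k<M. card (A k)) \<le> 2 * card (b ` S)"
      by (simp_all add: I_def)
    obtain B and c :: "'a \<Rightarrow> nat" where B: "B \<subseteq> S" "m M ` B \<subseteq> B"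
      and c: "\<And>x. c (p (partial_map (m M) B x)) = c x" "\<And>x y. c x = c y \<Longrightarrow> b x = b y"
      "2 * card (b ` S) + card B \<le> 2 * card (c ` S)"
      "\<And>x. x \<in> S \<Longrightarrow> m M x \<noteq> x \<Longrightarrow> c x \<noteq> c (m M x)"
      by (rule separate_by_involution[where m = "m M" and b = b, OF S m inv p b]) blast+
    define t where "t = partial_map (m M) B"
    have t: "t permutes S" unfolding t_def by (intro partial_map_permutes inv B)
    have tt: "t (t x) = x" for x
      using B inv by (auto simp: t_def partial_map_def)
    \<comment> \<open>After step \<open>M\<close> the sequence is constant, matching the empty sets
      \<open>A' k\<close>; this makes the recursion hold for every \<open>k\<close>.\<close>
    define E' where "E' k = (if k \<le> M then E k else t \<circ> E M)" for k
    define A' where "A' = A(M := B)"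
    have "E' (Suc k) x = partial_map (m k) (A' k) (E' k x)" for k x
    proof -
      consider "k < M" | "k = M" | "k > M" by linarith
      then show ?thesis
        by cases (auto simp: E'_def A'_def E t_def Aempty, simp add: partial_map_def)
    qed
    moreover have "E' k permutes S" for k
      by (simp add: E'_def Ep t permutes_compose)
    moreover have "A' k \<subseteq> S" for k using AS B by (simp add: A'_def)
    moreover have "(p \<circ> t) \<circ> E' (Suc M) = \<sigma>"
      using pE by (auto simp: E'_def tt fun_eq_iff)
    moreover have "(\<Sum>k<Suc M. card (A' k)) \<le> 2 * card (c ` S)"
      using sum c(3) by (simp add: A'_def)
    moreover have "\<forall>k<Suc M. \<forall>x\<in>S. m k x \<noteq> x \<longrightarrow> c x \<noteq> c (m k x)"
      using sep c(2,4) by (metis less_Suc_eq)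
    moreover have "p \<circ> t permutes S" by (intro permutes_compose t p)
    moreover have "\<forall>x. c ((p \<circ> t) x) = c x" using c(1) by (simp add: t_def)
    moreover have "E' 0 = id" "\<forall>k\<ge>Suc M. A' k = {}" by (simp_all add: E'_def E0 A'_def Aempty)
    ultimately have "I (Suc M) E' A' c (p \<circ> t)" by (simp add: I_def)
    then show ?case by blast
  qed
  then obtain E A b p where "I N E A b p" by blast
  then have E: "E 0 = id" "\<And>k. E k permutes S"
    "\<And>k. A k \<subseteq> S" "\<And>k x. E (Suc k) x = partial_map (m k) (A k) (E k x)"
    and p: "p permutes S" and pE: "p \<circ> E N = \<sigma>" and b: "\<And>x. b (p x) = b x"
    and sep: "\<And>k x. k < N \<Longrightarrow> x \<in> S \<Longrightarrow> m k x \<noteq> x \<Longrightarrow> b x \<noteq> b (m k x)"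
    and sum: "(\<Sum>k<N. card (A k)) \<le> 2 * card (b ` S)"
    by (simp_all add: I_def)
  \<comment> \<open>Every two distinct points have met and so carry different labels, whereas
    \<open>p\<close> preserves labels.\<close>
  have "p x = x" for x
  proof (rule ccontr)
    assume ne: "p x \<noteq> x"
    then have "x \<in> S" "p x \<in> S" using p by (auto simp: permutes_def permutes_in_image[OF p])
    then show False using meet[of x "p x"] sep ne b[of x] by metis
  qed
  then have "E N = \<sigma>" using pE by (auto simp: fun_eq_iff)
  moreover have "(\<Sum>k<N. card (A k)) \<le> 2 * card S"
    using sum card_image_le[OF S, of b] by linarith
  ultimately show ?thesis by (intro that[of E A] E)
qed

section \<open>The odd-even network\<close>

text \<open>
  A path in the network is a point that rotates by one step per unit of time on the circle of
  length \<open>2 n\<close>, folded to \<open>{1..n}\<close>; trajectory \<open>j\<close> starts at the point \<open>2 j\<close>.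
\<close>

definition pos :: "nat \<Rightarrow> nat \<Rightarrow> nat \<Rightarrow> nat" where
  "pos n k j = (let u = (2 * j + k) mod (2 * n) in if u < n then Suc u else 2 * n - u)"

text \<open>
  Trajectory \<open>j\<close> exchanges places with trajectory \<open>partner n k j\<close> in step \<open>k\<close>; it rests at a wall
  if the two are equal.
\<close>

definition partner :: "nat \<Rightarrow> nat \<Rightarrow> nat \<Rightarrow> nat" where
  "partner n k j = n - 1 - (j + k) mod n"

text \<open>Folding sends the points \<open>n - 1\<close> and \<open>n\<close> both to position
  \<open>n\<close>, and \<open>2 * n - 1\<close> and 0 both to position 1; these are the rests at
  the walls.\<close>

lemma pos_Suc:
  assumes "n > 0"
  shows "int (pos n (Suc k) j) - int (pos n k j) =
    (let u = (2 * j + k) mod (2 * n)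
     in if Suc u = n \<or> Suc u = 2 * n then 0 else if Suc u < n then 1 else -1)"
proof -
  define u where "u = (2 * j + k) mod (2 * n)"
  have "u < 2 * n" using assms by (simp add: u_def)
  moreover have "(2 * j + Suc k) mod (2 * n) = (if Suc u = 2 * n then 0 else Suc u)"
    unfolding u_def by (simp add: mod_Suc)
  ultimately show ?thesis using assms by (auto simp: pos_def Let_def u_def[symmetric])
qed

lemma pos_Suc_diff:
  assumes "n > 0"
  shows "\<bar>int (pos n (Suc k) j) - int (pos n k j)\<bar> \<le> 1"
  unfolding pos_Suc[OF assms] by (simp add: Let_def)

text \<open>A change of direction happens only at a wall, where a step of rest intervenes.\<close>

lemma pos_keeps_direction:
  assumes n: "n > 0" and ne: "pos n (Suc k) j \<noteq> pos n k j" "pos n (Suc (Suc k)) j \<noteq> pos n (Suc k) j"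
  shows "int (pos n (Suc (Suc k)) j) - int (pos n (Suc k) j) = int (pos n (Suc k) j) - int (pos n k j)"
proof -
  define u where "u = (2 * j + k) mod (2 * n)"
  have u: "u < 2 * n" using n by (simp add: u_def)
  have Suc: "(2 * j + Suc k) mod (2 * n) = (if Suc u = 2 * n then 0 else Suc u)"
    unfolding u_def by (simp add: mod_Suc)
  have "int (pos n (Suc k) j) - int (pos n k j) \<noteq> 0"
    "int (pos n (Suc (Suc k)) j) - int (pos n (Suc k) j) \<noteq> 0"
    using ne by auto
  then show ?thesis unfolding pos_Suc[OF n] Suc u_def[symmetric]
    using u by (auto simp: Let_def split: if_splits)
qed

lemma pos_in: "n > 0 \<Longrightarrow> pos n k j \<in> {1..n}"
  using mod_less_divisor[of "2 * n" "2 * j + k"] by (auto simp: pos_def Let_def simp del: mod_less_divisor)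

text \<open>The fold identifies only \<open>u\<close> with \<open>2 * n - 1 - u\<close>, which has
  the opposite parity, while all points occupied at time \<open>k\<close> have the parity of
  \<open>k\<close>.\<close>

lemma pos_inj_on: "inj_on (pos n k) {..<n}"
proof (rule inj_onI)
  fix i j assume ij: "i \<in> {..<n}" "j \<in> {..<n}" and eq: "pos n k i = pos n k j"
  define u v where "u = (2 * i + k) mod (2 * n)" and "v = (2 * j + k) mod (2 * n)"
  have uv: "u < 2 * n" "v < 2 * n" using ij by (auto simp: u_def v_def)
  have "u mod 2 = k mod 2" "v mod 2 = k mod 2"
    by (simp_all add: u_def v_def mod_mod_cancel)
  then have "even u \<longleftrightarrow> even v" by (simp add: even_iff_mod_2_eq_zero)
  moreover have "u + v + 1 = 2 * n" if "u = 2 * n - 1 - v" using that uv by simp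
  ultimately have "u \<noteq> 2 * n - 1 - v" by (metis dvd_triv_left even_add odd_one)
  moreover have "u = v \<or> u = 2 * n - 1 - v"
    using eq uv by (auto simp: pos_def u_def[symmetric] v_def[symmetric] split: if_splits)
  ultimately have "(2 * i + k) mod (2 * n) = (2 * j + k) mod (2 * n)" by (simp add: u_def v_def)
  then have "(2 * i) mod (2 * n) = (2 * j) mod (2 * n)"
    using cong_add_rcancel_nat[of "2 * i" k "2 * j" "2 * n"] by (simp add: cong_def)
  then show "i = j" using ij by simp
qed

lemma pos_bij_betw:
  assumes "n > 0"
  shows "bij_betw (pos n k) {..<n} {1..n}"
proof -
  have "pos n k ` {..<n} = {1..n}"
    by (rule card_subset_eq) (use pos_in[OF assms] in \<open>auto simp: card_image[OF pos_inj_on]\<close>)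
  then show ?thesis using pos_inj_on by (simp add: bij_betw_def)
qed

section \<open>Meetings of trajectories\<close>

lemma partner_less: "n > 0 \<Longrightarrow> partner n k j < n"
  by (simp add: partner_def)

text \<open>If \<open>j\<close> is at the point \<open>a\<close> at time \<open>k\<close>, its
  partner is at the mirror point \<open>2 * n - 1 - a\<close> at time \<open>k + 1\<close>, and the
  fold identifies the two.\<close>

lemma pos_Suc_partner:
  assumes "n > 0"
  shows "pos n (Suc k) (partner n k j) = pos n k j"
proof -
  define r q where "r = (j + k) mod n" and "q = (j + k) div n"
  define a p where "a = (2 * j + k) mod (2 * n)" and "p = (2 * j + k) div (2 * n)"
  have r: "j + k = r + n * q" "r < n" using assms by (auto simp: r_def q_def)
  have a: "2 * j + k = a + 2 * n * p" "a < 2 * n" using assms by (auto simp: a_def p_def)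
  \<comment> \<open>Multiples of \<open>2 * n\<close> are added on both sides so that the congruence
    becomes an equation of natural numbers.\<close>
  have "2 * (n - 1 - r) + Suc k + 2 * n * p = (2 * n - 1 - a) + 2 * n * q"
  proof -
    have "2 * (j + k) = 2 * r + 2 * (n * q)" using r by simp
    then show ?thesis using a r(2) by (simp add: mult.assoc)
  qed
  then have "(2 * (n - 1 - r) + Suc k) mod (2 * n) = (2 * n - 1 - a) mod (2 * n)"
    by (metis mod_mult_self2)
  also have "\<dots> = 2 * n - 1 - a" using assms by simp
  finally have "(2 * partner n k j + Suc k) mod (2 * n) = 2 * n - 1 - a"
    by (simp add: partner_def r_def)
  then show ?thesis using a(2) assms by (auto simp: pos_def Let_def a_def[symmetric])
qed

lemma partner_partner:
  assumes "j < n"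
  shows "partner n k (partner n k j) = j"
proof -
  define r q where "r = (j + k) mod n" and "q = (j + k) div n"
  have r: "j + k = r + n * q" "r < n" using assms by (auto simp: r_def q_def)
  have "n - 1 - r + k + n = (n - 1 - j) + n * Suc q" using r assms by simp
  then have "(n - 1 - r + k) mod n = (n - 1 - j) mod n"
    by (metis mod_add_self2 mod_mult_self2)
  also have "\<dots> = n - 1 - j" using assms by simp
  finally show ?thesis using assms by (simp add: partner_def r_def[symmetric])
qed

text \<open>The witness solves \<open>i + j + k = -1\<close> modulo \<open>n\<close>; the
  \<open>2 * n\<close> keeps the subtraction from being truncated.\<close>

lemma partner_eq_ex:
  assumes "i < n" "j < n"
  shows "\<exists>k<n. partner n k i = j"
proof (intro exI conjI)
  let ?k = "(2 * n - 1 - i - j) mod n"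
  show "?k < n" using assms by simp
  have "(i + ?k) mod n = (i + (2 * n - 1 - i - j)) mod n" by (simp add: mod_add_right_eq)
  also have "i + (2 * n - 1 - i - j) = (n - 1 - j) + n" using assms by simp
  also have "\<dots> mod n = (n - 1 - j) mod n" by (rule mod_add_self2)
  also have "\<dots> = n - 1 - j" using assms by simp
  finally show "partner n ?k i = j" using assms by (simp add: partner_def)
qed

lemma sum_card_swap:
  assumes "finite A" "finite B"
  shows "(\<Sum>i\<in>A. card {k\<in>B. P i k}) = (\<Sum>k\<in>B. card {i\<in>A. P i k})"
  unfolding card_eq_sum by (rule sum.swap_restrict[OF assms])

text \<open>Each trajectory rests at a wall at most once in \<open>n\<close> rounds, as
  \<open>partner n k j = j\<close> determines \<open>j + k\<close> modulo \<open>n\<close>.\<close>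

lemma sum_card_partner_fixed: "(\<Sum>k<n. card {j\<in>{..<n}. partner n k j = j}) \<le> n"
proof -
  have "card {k\<in>{..<n}. partner n k j = j} \<le> 1" if "j < n" for j
  proof -
    have "k = l" if kl: "k < n" "l < n" and "partner n k j = j" "partner n l j = j" for k l
    proof -
      have "(j + k) mod n < n" "(j + l) mod n < n" using kl by auto
      then have "(j + k) mod n = (j + l) mod n"
        using that unfolding partner_def by linarith
      then have "k mod n = l mod n" using cong_add_lcancel_nat[of j k l n] by (simp add: cong_def)
      then show ?thesis using kl by simp
    qed
    then show ?thesis by (auto simp: card_le_Suc0_iff_eq)
  qed
  then have "(\<Sum>j<n. card {k\<in>{..<n}. partner n k j = j}) \<le> (\<Sum>j<n. 1)" by (intro sum_mono) auto
  then show ?thesis by (subst sum_card_swap) auto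
qed

section \<open>Moves and rests\<close>

text \<open>A move is determined by its start, by maximality. It starts at index 0 or right after a
  rest, since otherwise \<open>keep\<close> would extend it to the left.\<close>

lemma card_moves_le:
  assumes len: "length xs = Suc N"
    and keep: "\<And>k. Suc k < N \<Longrightarrow> xs ! Suc k \<noteq> xs ! k \<Longrightarrow> xs ! Suc (Suc k) \<noteq> xs ! Suc k \<Longrightarrow>
      int (xs ! Suc (Suc k)) - int (xs ! Suc k) = int (xs ! Suc k) - int (xs ! k)"
  shows "card (moves xs) \<le> Suc (card {k\<in>{..<N}. xs ! Suc k = xs ! k})"
proof -
  let ?R = "{k\<in>{..<N}. xs ! Suc k = xs ! k}"
  have "inj_on fst (moves xs)"
  proof (rule inj_onI)
    fix x y assume xy: "x \<in> moves xs" "y \<in> moves xs" "fst x = fst y"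
    obtain a b b' where "x = (a, b)" "y = (a, b')" using xy by (metis prod.collapse)
    then show "x = y" using xy nat_le_linear[of b b'] unfolding moves_def is_move_def by blast
  qed
  moreover have "fst ` moves xs \<subseteq> insert 0 (Suc ` ?R)"
  proof clarify
    fix a b assume "(a, b) \<in> moves xs" and notin: "fst (a, b) \<notin> Suc ` ?R"
    then have move: "is_move xs a b" by (simp add: moves_def)
    then obtain d where ab: "a < b" "b < length xs" and d: "d \<in> {1, -1}"
      and run: "\<And>k. k \<in> {a..<b} \<Longrightarrow> int (xs ! Suc k) - int (xs ! k) = d"
      unfolding is_move_def monotone_run_def by blast
    have False if "a = Suc k" for k
    proof -
      have "k \<notin> ?R" using notin that by auto
      then have ne: "xs ! Suc k \<noteq> xs ! k" using ab len that by simp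
      have da: "int (xs ! Suc (Suc k)) - int (xs ! Suc k) = d" using run[of a] ab that by simp
      then have "xs ! Suc (Suc k) \<noteq> xs ! Suc k" using d by auto
      then have "int (xs ! Suc k) - int (xs ! k) = d" using keep[of k] ne da ab len that by simp
      then have "int (xs ! Suc l) - int (xs ! l) = d" if "l \<in> {k..<b}" for l
        using run[of l] that \<open>a = Suc k\<close> by (cases "l = k") auto
      moreover have "k < b" using ab that by simp
      ultimately have "monotone_run xs k b" unfolding monotone_run_def using ab(2) d by blast
      moreover have "k \<le> a" "k \<noteq> a" using that by auto
      ultimately show False using move unfolding is_move_def by blast
    qed
    then show "fst (a, b) = 0" by (cases a) auto
  qed
  ultimately have "card (moves xs) \<le> card (insert 0 (Suc ` ?R))"
    by (intro card_inj_on_le) auto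
  also have "\<dots> = Suc (card ?R)" by (simp add: card_image)
  finally show ?thesis .
qed

text \<open>\<open>Q k\<close> maps elements to positions, whereas the members of a tangle map
  positions to elements; hence the inverses.\<close>

lemma tangle_of_positions:
  assumes perm: "\<And>k. Q k permutes {1..n}"
    and diff: "\<And>k i. i \<in> {1..n} \<Longrightarrow> \<bar>int (Q (Suc k) i) - int (Q k i)\<bar> \<le> 1"
  shows "tangle n (map (\<lambda>k. inv (Q k)) [0..<Suc N])"
    and "path (map (\<lambda>k. inv (Q k)) [0..<Suc N]) i = map (\<lambda>k. Q k i) [0..<Suc N]"
proof -
  let ?T = "map (\<lambda>k. inv (Q k)) [0..<Suc N]"
  have inv: "inv (inv (Q k)) = Q k" for k
    using perm permutes_inv_inv by blast
  have "adjacent_perms n (inv (Q k)) (inv (Q (Suc k)))" for k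
    unfolding adjacent_perms_def inv using diff by (metis abs_minus_commute)
  then have "successively (adjacent_perms n) ?T"
    by (simp add: successively_conv_nth del: upt_Suc)
  then show "tangle n ?T"
    using perm by (auto simp: tangle_def permutes_inv)
  show "path ?T i = map (\<lambda>k. Q k i) [0..<Suc N]"
    by (simp add: path_def inv)
qed

section \<open>Assembling the tangle and counting its rests\<close>

theorem theorem2:
  fixes n :: nat and \<pi> :: "nat \<Rightarrow> nat"
  assumes "n \<ge> 1" and "\<pi> permutes {1..n}"
  shows "\<exists>T. tangle n T \<and> performs T \<pi> \<and> total_moves n T \<le> 4 * n"
proof -
  have n: "n > 0" using assms by simp
  define S where "S = {..<n}"
  define f where "f k = inv_into S (pos n k)" for k
  have f: "bij_betw (f k) {1..n} S" for k
    unfolding f_def S_def by (rule bij_betw_inv_into[OF pos_bij_betw[OF n]])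
  have pf: "pos n k (f k i) = i" if "i \<in> {1..n}" for k i
    unfolding f_def S_def using bij_betw_inv_into_right[OF pos_bij_betw[OF n]] that by blast
  have fp: "f k (pos n k j) = j" if "j \<in> S" for k j
    unfolding f_def using bij_betw_inv_into_left[OF pos_bij_betw[OF n]] that by (simp add: S_def)
  have pos: "bij_betw (pos n k) S {1..n}" for k
    unfolding S_def by (rule pos_bij_betw[OF n])
  have \<pi>': "inv \<pi> permutes {1..n}" using assms(2) by (rule permutes_inv)
  \<comment> \<open>The element starting on trajectory \<open>j\<close> is \<open>pos n 0 j\<close>;
    it must end at its position in \<pi>, and \<open>f n\<close> finds the trajectory that ends
    there.\<close>
  define \<sigma> where "\<sigma> j = (if j \<in> S then f n (inv \<pi> (pos n 0 j)) else j)" for j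
  have "bij_betw (f n \<circ> inv \<pi> \<circ> pos n 0) S S"
    by (intro bij_betw_trans[OF pos] bij_betw_trans[OF permutes_imp_bij[OF \<pi>'] f])
  then have "bij_betw \<sigma> S S" by (rule bij_betw_cong[THEN iffD1, rotated]) (simp add: \<sigma>_def)
  then have \<sigma>: "\<sigma> permutes S" by (rule bij_imp_permutes) (simp add: \<sigma>_def)
  obtain E A where E0: "E 0 = id" and En: "E n = \<sigma>" and Ep: "\<And>k. E k permutes S"
    and E: "\<And>k x. E (Suc k) x = partial_map (partner n k) (A k) (E k x)"
    and AS: "\<And>k. A k \<subseteq> S" and sumA: "(\<Sum>k<n. card (A k)) \<le> 2 * card S"
    by (rule factor_by_involutions[of S "partner n" n \<sigma>])
      (use \<sigma> n in \<open>auto simp: S_def partner_less partner_partner partner_eq_ex\<close>)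
  \<comment> \<open>Element \<open>i\<close> starts on trajectory \<open>f 0 i\<close> and rides on
    \<open>E k (f 0 i)\<close> at time \<open>k\<close>.\<close>
  define Q where "Q k i = (if i \<in> {1..n} then pos n k (E k (f 0 i)) else i)" for k i
  have EfS: "E k (f 0 i) \<in> S" if "i \<in> {1..n}" for k i
    using bij_betw_apply[OF f that] by (simp add: permutes_in_image[OF Ep])
  have Qp: "Q k permutes {1..n}" for k
  proof (rule bij_imp_permutes)
    have "bij_betw (pos n k \<circ> (E k \<circ> f 0)) {1..n} {1..n}"
      by (rule bij_betw_trans[OF bij_betw_trans[OF f permutes_imp_bij[OF Ep]] pos])
    then show "bij_betw (Q k) {1..n} {1..n}"
      by (rule bij_betw_cong[THEN iffD1, rotated]) (simp add: Q_def)
  qed (simp only: Q_def if_False)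
  \<comment> \<open>Switching to the partner means resting, because the partner arrives at the place
    just held.\<close>
  have stay: "Q (Suc k) i = Q k i" if "i \<in> {1..n}" "E k (f 0 i) \<in> A k" for k i
    using that by (simp add: Q_def E partial_map_def pos_Suc_partner[OF n])
  have go: "E (Suc k) (f 0 i) = E k (f 0 i)" if "E k (f 0 i) \<notin> A k" for k i
    using that by (simp add: E partial_map_def)
  have diff: "\<bar>int (Q (Suc k) i) - int (Q k i)\<bar> \<le> 1" if "i \<in> {1..n}" for k i
    using stay[of i k] go[of k i] pos_Suc_diff[OF n, of k "E k (f 0 i)"] that
    by (cases "E k (f 0 i) \<in> A k") (auto simp: Q_def)
  define T where "T = map (\<lambda>k. inv (Q k)) [0..<Suc n]"
  have tangle: "tangle n T" and path: "\<And>i. path T i = map (\<lambda>k. Q k i) [0..<Suc n]"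
    unfolding T_def using tangle_of_positions[of Q n n] Qp diff by blast+
  have "Q 0 = id" by (auto simp: Q_def E0 pf)
  moreover have "Q n = inv \<pi>"
  proof
    fix i show "Q n i = inv \<pi> i"
    proof (cases "i \<in> {1..n}")
      case True
      then have "f 0 i \<in> S" "inv \<pi> i \<in> {1..n}"
        using bij_betw_apply[OF f] by (auto simp only: permutes_in_image[OF \<pi>'])
      then show ?thesis using True by (simp add: Q_def En \<sigma>_def pf)
    next
      case False
      then show ?thesis by (simp add: Q_def permutes_not_in[OF \<pi>'] del: atLeastAtMost_iff)
    qed
  qed
  ultimately have performs: "performs T \<pi>"
    using permutes_inv_inv[OF assms(2)] n by (simp add: performs_def T_def upt_rec[of 0] last_map)
  have "card (moves (path T i)) \<le> Suc (card {k\<in>{..<n}. Q (Suc k) i = Q k i})" if i: "i \<in> {1..n}" for i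
  proof -
    have len: "length (path T i) = Suc n" by (simp add: path)
    have nth: "path T i ! k = Q k i" if "k \<le> n" for k
      using that by (simp add: path nth_append del: upt_Suc)
    have "int (Q (Suc (Suc k)) i) - int (Q (Suc k) i) = int (Q (Suc k) i) - int (Q k i)"
      if ne: "Q (Suc k) i \<noteq> Q k i" "Q (Suc (Suc k)) i \<noteq> Q (Suc k) i" for k
    proof -
      \<comment> \<open>Two steps without rest involve no exchange, so the element follows a single
        trajectory.\<close>
      have "E (Suc k) (f 0 i) = E k (f 0 i)" "E (Suc (Suc k)) (f 0 i) = E (Suc k) (f 0 i)"
        using ne stay[OF i] go by metis+
      then show ?thesis using ne i pos_keeps_direction[OF n] by (simp add: Q_def)
    qed
    then have "card (moves (path T i)) \<le> Suc (card {k\<in>{..<n}. path T i ! Suc k = path T i ! k})"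
      by (intro card_moves_le) (simp_all add: nth len)
    also have "{k\<in>{..<n}. path T i ! Suc k = path T i ! k} = {k\<in>{..<n}. Q (Suc k) i = Q k i}"
      by (auto simp: nth)
    finally show ?thesis .
  qed
  then have "total_moves n T \<le> (\<Sum>i\<in>{1..n}. Suc (card {k\<in>{..<n}. Q (Suc k) i = Q k i}))"
    unfolding total_moves_def by (rule sum_mono)
  also have "\<dots> = n + (\<Sum>i\<in>{1..n}. card {k\<in>{..<n}. Q (Suc k) i = Q k i})"
    by (simp only: sum_Suc) simp
  also have "(\<Sum>i\<in>{1..n}. card {k\<in>{..<n}. Q (Suc k) i = Q k i}) =
      (\<Sum>k<n. card {i\<in>{1..n}. Q (Suc k) i = Q k i})"
    by (rule sum_card_swap) auto
  also have "\<dots> \<le> (\<Sum>k<n. card (A k) + card {j\<in>{..<n}. partner n k j = j})"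
  proof (rule sum_mono)
    fix k
    let ?g = "\<lambda>i. E k (f 0 i)"
    have "inj_on ?g {1..n}"
      by (rule bij_betw_imp_inj_on[OF bij_betw_trans[OF f permutes_imp_bij[OF Ep]], unfolded comp_def])
    then have inj: "inj_on ?g {i\<in>{1..n}. Q (Suc k) i = Q k i}"
      by (rule inj_on_subset) auto
    \<comment> \<open>The resting elements of round \<open>k\<close> are counted by their
      trajectories: a rest without exchange puts the trajectory where its partner goes, so the two
      coincide by injectivity.\<close>
    have "?g i \<in> A k \<union> {j\<in>{..<n}. partner n k j = j}"
      if i: "i \<in> {1..n}" and eq: "Q (Suc k) i = Q k i" for i
    proof (cases "?g i \<in> A k")
      case False
      have "pos n (Suc k) (?g i) = pos n (Suc k) (partner n k (?g i))"
        using eq i go[OF False] by (simp add: Q_def pos_Suc_partner[OF n])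
      moreover have "?g i < n" using EfS[OF i] by (simp add: S_def)
      ultimately have "?g i = partner n k (?g i)"
        using inj_onD[OF pos_inj_on, of n "Suc k" "?g i" "partner n k (?g i)"] partner_less[OF n] by simp
      then show ?thesis using \<open>?g i < n\<close> by simp
    qed auto
    then have sub: "?g ` {i\<in>{1..n}. Q (Suc k) i = Q k i} \<subseteq> A k \<union> {j\<in>{..<n}. partner n k j = j}"
      by blast
    have "finite (A k)" using finite_subset[OF AS] by (simp add: S_def)
    then have "card {i\<in>{1..n}. Q (Suc k) i = Q k i} \<le> card (A k \<union> {j\<in>{..<n}. partner n k j = j})"
      by (intro card_inj_on_le[OF inj sub]) auto
    also have "\<dots> \<le> card (A k) + card {j\<in>{..<n}. partner n k j = j}" by (rule card_Un_le)
    finally show "card {i\<in>{1..n}. Q (Suc k) i = Q k i} \<le>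
      card (A k) + card {j\<in>{..<n}. partner n k j = j}" .
  qed
  also have "\<dots> \<le> 2 * n + n"
    using sumA sum_card_partner_fixed[of n] by (simp add: sum.distrib S_def)
  finally have "total_moves n T \<le> 4 * n" by simp
  then show ?thesis using tangle performs by blast
qed

end
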